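(* Let $n\geq 2$ be an odd integer. Then for every integer $k > (n-1)^2+2$, $$a_n(k) = 2a_n(k-1)-2a_n(k-3)+a_n(k-4).$$
   Context: For integers $n\geq 1$ and $k\geq 0$, the $n$ by $k$ grid is the set of points $\{1,\dots,n\}\times\{1,\dots,k\}\subset\mathbb{R}^2$ (empty if $k=0$). $a_n(k)$ denotes the number of isosceles triangles of nonzero area formed by 3 distinct points of the $n$ by $k$ grid, i.e. the number of 3-element subsets of the grid that are non-collinear and are the vertices of a triangle having at least two sides of equal Euclidean length. *)

theory Defs
  imports "HOL-Analysis.Analysis"
begin

definition grid :: "nat \<Rightarrow> nat \<Rightarrow> (real \<times> real) set" where
  "grid n k = (\<lambda>(i, j). (real i, real j)) ` ({1..n} \<times> {1..k})"

text \<open>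
  A triangle is represented by its set of vertices. Equilateral triangles count as isosceles,
  and since the product metric on \<^typ>\<open>real \<times> real\<close> is Euclidean, \<^const>\<open>dist\<close> is the side length.
\<close>

definition isosceles_triangle :: "(real \<times> real) set \<Rightarrow> bool" where
  "isosceles_triangle T \<longleftrightarrow> card T = 3 \<and> \<not> collinear T \<and>
     (\<exists>p q r. T = {p, q, r} \<and> dist p q = dist p r)"

definition num_isosceles :: "nat \<Rightarrow> nat \<Rightarrow> nat" where
  "num_isosceles n k = card {T. T \<subseteq> grid n k \<and> isosceles_triangle T}"

end

theory Submission
  imports Defs
begin

text \<open>
  Let \<open>s(h)\<close> be the number of isosceles triangles in the grid with \<open>h + 1\<close> rows that touch both
  its first and its last row. Counting by inclusion-exclusion the triangles that miss one of these
  rows gives \<open>a(k) - 2a(k - 1) + a(k - 2) = s(k - 1)\<close> (lemma \<open>second_difference\<close>). The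
  characteristic polynomial of the recurrence is
  \<open>x\<^sup>4 - 2x\<^sup>3 + 2x - 1 = (x - 1)\<^sup>2 (x\<^sup>2 - 1)\<close>, so the recurrence says that
  \<open>s(k - 1) = s(k - 3)\<close>.

  Once \<open>h \<ge> (n - 1)\<^sup>2\<close>, the numbers \<open>s(h)\<close> depend only on the parity of \<open>h\<close>. Indeed, the squared
  horizontal extents of the two equal sides differ by at most \<open>(n - 1)\<^sup>2\<close>, while, for odd \<open>n\<close>, two
  different squared vertical extents of sides meeting in the apex of a triangle of height \<open>h\<close> differ by
  more than that. Hence the equal sides have equal vertical extents, and the vertices lie on the first, the last or the
  middle row (lemma \<open>tall_isosceles_rows\<close>). Such a triangle remains an isosceles grid triangle when
  the plane is stretched vertically to another height of the same parity (lemma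
  \<open>stretch_spanning\<close>), and stretching is injective in both directions.

  The oddness of \<open>n\<close> matters at a single height, \<open>h = (n - 1)\<^sup>2\<close>: there an apex half a row away from
  the middle would make up for the largest possible horizontal difference, which requires \<open>h\<close> odd,
  while \<open>(n - 1)\<^sup>2\<close> is even.
\<close>

section \<open>Triangles spanning all rows\<close>

definition spanning :: "nat \<Rightarrow> nat \<Rightarrow> (real \<times> real) set set" where
  "spanning n h = {T. T \<subseteq> grid n (h + 1) \<and> isosceles_triangle T \<and>
     (\<exists>p\<in>T. snd p = 1) \<and> (\<exists>p\<in>T. snd p = real h + 1)}"

lemma mem_grid:
  "p \<in> grid n k \<longleftrightarrow> (\<exists>i j. p = (real i, real j) \<and> i \<in> {1..n} \<and> j \<in> {1..k})"
  by (auto simp: grid_def image_iff)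

lemma finite_grid: "finite (grid n k)"
  by (simp add: grid_def)

lemma finite_spanning: "finite (spanning n h)"
  by (rule finite_subset[of _ "Pow (grid n (h + 1))"]) (auto simp: spanning_def finite_grid)

lemma grid_without_top_row: "{p \<in> grid n (Suc k). snd p \<noteq> real k + 1} = grid n k"
proof (rule set_eqI)
  fix p
  show "p \<in> {p \<in> grid n (Suc k). snd p \<noteq> real k + 1} \<longleftrightarrow> p \<in> grid n k"
    by (auto simp: mem_grid le_Suc_eq)
qed

lemma grid_without_bottom_row:
  "{p \<in> grid n (Suc k). snd p \<noteq> 1} = (+) (0, 1) ` grid n k"
proof (intro equalityI subsetI)
  fix p assume "p \<in> {p \<in> grid n (Suc k). snd p \<noteq> 1}"
  then obtain i j where p: "p = (real i, real j)" "i \<in> {1..n}" "j \<in> {1..Suc k}" "j \<noteq> 1"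
    by (auto simp: mem_grid)
  then have "j - 1 \<in> {1..k}" by auto
  with p have "(real i, real (j - 1)) \<in> grid n k" unfolding mem_grid by blast
  moreover have "p = (0, 1) + (real i, real (j - 1))"
    using p by (auto simp: of_nat_diff)
  ultimately show "p \<in> (+) (0, 1) ` grid n k" by blast
next
  fix p assume "p \<in> (+) (0, 1) ` grid n k"
  then obtain i j where p: "p = (real i, real (Suc j))" "i \<in> {1..n}" "j \<in> {1..k}"
    by (auto simp: mem_grid)
  then have "Suc j \<in> {1..Suc k}" by auto
  with p have "p \<in> grid n (Suc k)" unfolding mem_grid by blast
  moreover have "snd p \<noteq> 1" using p by simp
  ultimately show "p \<in> {p \<in> grid n (Suc k). snd p \<noteq> 1}" by blast
qed

text \<open>The grid without its first row is not a grid itself but a translate of one, so that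
  counting the triangles that miss the first row needs translation invariance.\<close>

lemma isosceles_triangle_translation:
  assumes "isosceles_triangle T"
  shows "isosceles_triangle ((+) a ` T)"
proof -
  obtain p q r where T: "card T = 3" "\<not> collinear T" "T = {p, q, r}" "dist p q = dist p r"
    using assms by (auto simp: isosceles_triangle_def)
  have "card ((+) a ` T) = 3"
    using T(1) by (simp add: card_image)
  moreover have "\<not> collinear ((+) a ` T)"
    using T(2) by (auto simp: collinear_def)
  moreover have "(+) a ` T = {a + p, a + q, a + r}" "dist (a + p) (a + q) = dist (a + p) (a + r)"
    using T by (auto simp: dist_norm)
  ultimately show ?thesis unfolding isosceles_triangle_def by blast
qed

lemma card_isosceles_translated_grid:
  "card {T. T \<subseteq> (+) a ` grid n k \<and> isosceles_triangle T} = num_isosceles n k"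
proof -
  have "bij_betw ((`) ((+) a)) {T. T \<subseteq> grid n k \<and> isosceles_triangle T}
          {T. T \<subseteq> (+) a ` grid n k \<and> isosceles_triangle T}"
  proof (rule bij_betw_byWitness[where f' = "(`) (\<lambda>x. x - a)"])
    have "isosceles_triangle ((\<lambda>x. x - a) ` T)" if "isosceles_triangle T" for T
      using isosceles_triangle_translation[OF that, of "- a"] by simp
    then show "(`) (\<lambda>x. x - a) ` {T. T \<subseteq> (+) a ` grid n k \<and> isosceles_triangle T}
        \<subseteq> {T. T \<subseteq> grid n k \<and> isosceles_triangle T}"
      by auto
  qed (auto simp: image_image intro!: isosceles_triangle_translation)
  then show ?thesis by (simp add: num_isosceles_def bij_betw_same_card)
qed

text \<open>A triangle is spanning unless it misses the first row or the last row. Each of these two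
  conditions confines it to a grid with one row less, and both together to a grid with two rows
  less.\<close>

lemma second_difference:
  "int (num_isosceles n (h + 2)) - 2 * int (num_isosceles n (h + 1)) + int (num_isosceles n h)
     = int (card (spanning n (h + 1)))"
proof -
  let ?all = "{T. T \<subseteq> grid n (h + 2) \<and> isosceles_triangle T}"
  let ?B = "{T \<in> ?all. \<forall>p\<in>T. snd p \<noteq> 1}"
  let ?T = "{T \<in> ?all. \<forall>p\<in>T. snd p \<noteq> real (h + 1) + 1}"
  have fin: "finite ?all"
    by (rule finite_subset[of _ "Pow (grid n (h + 2))"]) (auto simp: finite_grid)
  have bottom: "{p \<in> grid n (h + 2). snd p \<noteq> 1} = (+) (0, 1) ` grid n (h + 1)"
    using grid_without_bottom_row[of n "h + 1"] by simp
  have top: "{p \<in> grid n (h + 2). snd p \<noteq> real (h + 1) + 1} = grid n (h + 1)"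
    using grid_without_top_row[of n "h + 1"] by simp
  have B: "card ?B = num_isosceles n (h + 1)"
  proof -
    have "?B = {T. T \<subseteq> (+) (0, 1) ` grid n (h + 1) \<and> isosceles_triangle T}"
      unfolding bottom[symmetric] by auto
    then show ?thesis by (simp only: card_isosceles_translated_grid)
  qed
  have T: "card ?T = num_isosceles n (h + 1)"
  proof -
    have "?T = {T. T \<subseteq> grid n (h + 1) \<and> isosceles_triangle T}"
      unfolding top[symmetric] by auto
    then show ?thesis by (simp only: num_isosceles_def)
  qed
  have BT: "card (?B \<inter> ?T) = num_isosceles n h"
  proof -
    have "?B \<inter> ?T = {T. T \<subseteq> {p \<in> grid n (h + 1). snd p \<noteq> 1} \<and> isosceles_triangle T}"
      unfolding top[symmetric] by auto
    also have "{p \<in> grid n (h + 1). snd p \<noteq> 1} = (+) (0, 1) ` grid n h"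
      using grid_without_bottom_row[of n h] by simp
    finally show ?thesis by (simp only: card_isosceles_translated_grid)
  qed
  have spanning: "spanning n (h + 1) = ?all - (?B \<union> ?T)"
    by (auto simp: spanning_def)
  have "card ?all = card (spanning n (h + 1)) + card (?B \<union> ?T)"
  proof -
    have sub: "?B \<union> ?T \<subseteq> ?all" by blast
    show ?thesis
      unfolding spanning
      using card_Diff_subset[OF finite_subset[OF sub fin] sub] card_mono[OF fin sub] by linarith
  qed
  moreover have "card ?B + card ?T = card (?B \<union> ?T) + card (?B \<inter> ?T)"
    by (rule card_Un_Int) (rule finite_subset[OF _ fin], blast)+
  moreover have "card ?all = num_isosceles n (h + 2)"
    by (simp add: num_isosceles_def)
  ultimately show ?thesis using B T BT by linarith
qed

section \<open>Shape of the spanning triangles in a tall grid\<close>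

text \<open>
  Here \<open>(x1, u)\<close> is the apex, \<open>N\<close> the width of the grid and \<open>h\<close> its height. The two vertices on the
  extreme rows are either the apex and a base vertex, or the two base vertices. In the first case
  the squared vertical extents of the equal sides are \<open>h\<^sup>2\<close> and \<open>a\<^sup>2\<close> with \<open>0 \<le> a \<le> h\<close>, which differ
  by at least \<open>2h - 1 > N\<^sup>2\<close> unless \<open>a = h\<close>. In the second case they differ by \<open>h \<bar>2u - h\<bar>\<close>, which
  exceeds \<open>N\<^sup>2\<close> unless \<open>2u = h\<close>, or \<open>\<bar>2u - h\<bar> = 1\<close> and \<open>h = N\<^sup>2\<close>; the last option would make the even
  number \<open>N\<^sup>2\<close> odd.
\<close>

lemma tall_isosceles_rows:
  fixes N h x1 x2 x3 u v w :: int
  assumes N: "N \<ge> 2" "even N" "N\<^sup>2 \<le> h"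
    and x: "\<bar>x1 - x2\<bar> \<le> N" "\<bar>x1 - x3\<bar> \<le> N"
    and rows: "u \<in> {0..h}" "v \<in> {0..h}" "w \<in> {0..h}" "0 \<in> {u, v, w}" "h \<in> {u, v, w}"
    and eq: "(x1 - x2)\<^sup>2 + (u - v)\<^sup>2 = (x1 - x3)\<^sup>2 + (u - w)\<^sup>2"
  shows "(u - v)\<^sup>2 = (u - w)\<^sup>2"
    and "y \<in> {u, v, w} \<Longrightarrow> y = 0 \<or> 2 * y = h \<or> y = h"
proof -
  have N4: "2 * 2 \<le> N\<^sup>2" using N(1) unfolding power2_eq_square by (intro mult_mono) auto
  then have h4: "4 \<le> h" using N(3) by simp
  have "(x1 - x2)\<^sup>2 \<le> N\<^sup>2" "(x1 - x3)\<^sup>2 \<le> N\<^sup>2"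
    using x N(1) by (simp_all add: abs_le_square_iff[symmetric])
  moreover have "0 \<le> (x1 - x2)\<^sup>2" "0 \<le> (x1 - x3)\<^sup>2" by simp_all
  ultimately have le: "\<bar>(u - v)\<^sup>2 - (u - w)\<^sup>2\<bar> \<le> N\<^sup>2" using eq by linarith
  have near: "a = h" if "h\<^sup>2 - a\<^sup>2 \<le> N\<^sup>2" "0 \<le> a" "a \<le> h" for a
  proof (rule ccontr)
    assume "a \<noteq> h"
    then have "a\<^sup>2 \<le> (h - 1)\<^sup>2" using that by (intro power_mono) auto
    then have "2 * h - 1 \<le> h\<^sup>2 - a\<^sup>2" by (simp add: power2_eq_square algebra_simps)
    then show False using that N h4 by linarith
  qed
  have middle: "2 * u = h" if "\<bar>h * (2 * u - h)\<bar> \<le> N\<^sup>2"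
  proof (rule ccontr)
    assume "2 * u \<noteq> h"
    then have ge: "1 \<le> \<bar>2 * u - h\<bar>" by simp
    have prod: "h * \<bar>2 * u - h\<bar> \<le> N\<^sup>2"
      using that h4 by (simp add: abs_mult)
    then have "h * \<bar>2 * u - h\<bar> \<le> h * 1" using N(3) by linarith
    then have "\<bar>2 * u - h\<bar> \<le> 1" using h4 by (simp only: mult_le_cancel_left)
    with ge have one: "\<bar>2 * u - h\<bar> = 1" by simp
    then have "odd h" by presburger
    \<comment> \<open>The product bound now forces equality in \<open>N\<^sup>2 \<le> h\<close>, at which height \<open>h\<close> is even.\<close>
    moreover have "h = N\<^sup>2" using prod N(3) by (simp add: one)
    ultimately show False using N(2) by simp
  qed
  have cases: "(u = 0 \<and> (v = h \<or> w = h)) \<or> (u = h \<and> (v = 0 \<or> w = 0)) \<or> (v = 0 \<and> w = h) \<or> (v = h \<and> w = 0)"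
    using rows(4,5) h4 by auto
  have shape: "(u = 0 \<and> v = h \<and> w = h) \<or> (u = h \<and> v = 0 \<and> w = 0) \<or>
      (2 * u = h \<and> (v = 0 \<and> w = h \<or> v = h \<and> w = 0))"
    using cases
  proof (elim disjE conjE)
    assume "u = 0" "v = h"
    then show ?thesis using near[of w] le rows(3) by auto
  next
    assume "u = 0" "w = h"
    then show ?thesis using near[of v] le rows(2) by auto
  next
    assume "u = h" "v = 0"
    then show ?thesis using near[of "h - w"] le rows(3) by auto
  next
    assume "u = h" "w = 0"
    then show ?thesis using near[of "h - v"] le rows(2) by auto
  next
    assume *: "v = 0" "w = h"
    have "(u - v)\<^sup>2 - (u - w)\<^sup>2 = h * (2 * u - h)"
      using * by (simp add: power2_eq_square algebra_simps)
    then show ?thesis using middle le * by simp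
  next
    assume *: "v = h" "w = 0"
    have "(u - v)\<^sup>2 - (u - w)\<^sup>2 = - (h * (2 * u - h))"
      using * by (simp add: power2_eq_square algebra_simps)
    then show ?thesis using middle le * by simp
  qed
  show "(u - v)\<^sup>2 = (u - w)\<^sup>2" using shape by (auto simp: power2_eq_square)
  show "y = 0 \<or> 2 * y = h \<or> y = h" if "y \<in> {u, v, w}" using shape that by auto
qed

section \<open>Stretching spanning triangles to another height\<close>

text \<open>The fixed row of the stretching is \<open>1\<close>, the first row of every grid, so that a factor
  \<open>h' / h\<close> takes row \<open>h + 1\<close> to row \<open>h' + 1\<close>.\<close>

definition stretch :: "real \<Rightarrow> real \<times> real \<Rightarrow> real \<times> real" where
  "stretch c p = (fst p, 1 + c * (snd p - 1))"

lemma stretch_inverse: "c \<noteq> 0 \<Longrightarrow> stretch (inverse c) (stretch c p) = p"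
  by (cases p) (simp add: stretch_def mult.assoc[symmetric])

lemma inj_stretch: "c \<noteq> 0 \<Longrightarrow> inj (stretch c)"
  by (rule inj_on_inverseI[where g = "stretch (inverse c)"]) (rule stretch_inverse)

lemma collinear_stretch:
  assumes "collinear S"
  shows "collinear (stretch c ` S)"
proof -
  obtain u where u: "\<forall>p\<in>S. \<forall>q\<in>S. \<exists>t. p - q = t *\<^sub>R u"
    using assms unfolding collinear_def by blast
  have "\<exists>t. stretch c p - stretch c q = t *\<^sub>R (fst u, c * snd u)" if pq: "p \<in> S" "q \<in> S" for p q
  proof -
    obtain t where t: "p - q = t *\<^sub>R u" using u pq by blast
    have "fst p - fst q = t * fst u" "snd p - snd q = t * snd u"
      using arg_cong[OF t, of fst] arg_cong[OF t, of snd] by simp_all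
    then have "stretch c p - stretch c q = t *\<^sub>R (fst u, c * snd u)"
      by (simp add: stretch_def algebra_simps)
    then show ?thesis by blast
  qed
  then show ?thesis unfolding collinear_def by blast
qed

text \<open>
  Stretching does not preserve equality of lengths in general. It does here because the
  equal sides agree in their vertical extents, hence also in their horizontal ones. The vertices stay
  on the grid because their heights above the first row are \<open>0\<close>, \<open>h / 2\<close> or \<open>h\<close>; if \<open>h / 2\<close> occurs, then
  \<open>h\<close> is even, so \<open>h'\<close> is even and \<open>h' / 2\<close> is an integer.
\<close>

lemma stretch_spanning:
  assumes n: "n \<ge> 2" "odd n" and h: "(n - 1)\<^sup>2 \<le> h" "(n - 1)\<^sup>2 \<le> h'" "even h = even h'"
    and T: "T \<in> spanning n h"
  shows "stretch (real h' / real h) ` T \<in> spanning n h'"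
proof -
  define c where "c = real h' / real h"
  have n3: "n \<ge> 3" using n by presburger
  have "0 < (n - 1)\<^sup>2" using n by simp
  then have hpos: "0 < h" "0 < h'" using h by linarith+
  then have c: "c \<noteq> 0" "c * real h = real h'" by (simp_all add: c_def)
  obtain p q r where iso: "card T = 3" "\<not> collinear T" "T = {p, q, r}" "dist p q = dist p r"
    using T by (auto simp: spanning_def isosceles_triangle_def)
  have coords: "\<exists>i y. s = (real i, real y + 1) \<and> i \<in> {1..n} \<and> y \<le> h" if "s \<in> T" for s
  proof -
    have "s \<in> grid n (h + 1)" using that T by (auto simp: spanning_def)
    then obtain i j where "s = (real i, real j)" "i \<in> {1..n}" "j \<in> {1..h + 1}"
      by (auto simp: mem_grid)
    then have "s = (real i, real (j - 1) + 1)" "i \<in> {1..n}" "j - 1 \<le> h"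
      by auto
    then show ?thesis by blast
  qed
  obtain x1 u where p: "p = (real x1, real u + 1)" "x1 \<in> {1..n}" "u \<le> h" using coords[of p] iso by auto
  obtain x2 v where q: "q = (real x2, real v + 1)" "x2 \<in> {1..n}" "v \<le> h" using coords[of q] iso by auto
  obtain x3 w where r: "r = (real x3, real w + 1)" "x3 \<in> {1..n}" "w \<le> h" using coords[of r] iso by auto
  have ends: "0 \<in> {u, v, w}" "h \<in> {u, v, w}"
    using T p q r iso(3) by (auto simp: spanning_def)
  have "(real x1 - real x2)\<^sup>2 + (real u - real v)\<^sup>2 = (real x1 - real x3)\<^sup>2 + (real u - real w)\<^sup>2"
    using iso(4) p q r by (simp add: dist_Pair_Pair dist_real_def)
  then have "real_of_int ((int x1 - int x2)\<^sup>2 + (int u - int v)\<^sup>2)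
      = real_of_int ((int x1 - int x3)\<^sup>2 + (int u - int w)\<^sup>2)"
    by simp
  then have eq: "(int x1 - int x2)\<^sup>2 + (int u - int v)\<^sup>2 = (int x1 - int x3)\<^sup>2 + (int u - int w)\<^sup>2"
    by (simp only: of_int_eq_iff)
  have hint: "(int n - 1)\<^sup>2 \<le> int h"
  proof -
    have "int ((n - 1)\<^sup>2) \<le> int h" using h(1) by (simp only: of_nat_le_iff)
    then show ?thesis using n by (simp add: of_nat_diff)
  qed
  have prems: "2 \<le> int n - 1" "even (int n - 1)" "(int n - 1)\<^sup>2 \<le> int h"
    "\<bar>int x1 - int x2\<bar> \<le> int n - 1" "\<bar>int x1 - int x3\<bar> \<le> int n - 1"
    "int u \<in> {0..int h}" "int v \<in> {0..int h}" "int w \<in> {0..int h}"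
    "0 \<in> {int u, int v, int w}" "int h \<in> {int u, int v, int w}"
    using n n3 hint p q r ends by auto
  note shape = tall_isosceles_rows[OF prems eq]
  have dy: "(real u - real v)\<^sup>2 = (real u - real w)\<^sup>2"
    using arg_cong[OF shape(1), of real_of_int] by simp
  with iso(4) have dx: "(real x1 - real x2)\<^sup>2 = (real x1 - real x3)\<^sup>2"
    using p q r by (simp add: dist_Pair_Pair dist_real_def)
  have rows: "y = 0 \<or> 2 * y = h \<or> y = h" if "y \<in> {u, v, w}" for y
    using shape(2)[of "int y"] that by auto
  have row: "\<exists>j. c * real y = real j \<and> j \<le> h'" if "y \<in> {u, v, w}" for y
    using rows[OF that]
  proof (elim disjE)
    assume y: "2 * y = h"
    then obtain j where j: "h' = 2 * j" using h(3) by (metis dvd_triv_left evenE)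
    have "2 * (c * real y) = 2 * real j" using c(2) y j by auto
    then show ?thesis using j by auto
  qed (use c in auto)
  let ?T = "stretch c ` T"
  have im: "stretch c p = (real x1, 1 + c * real u)" "stretch c q = (real x2, 1 + c * real v)"
      "stretch c r = (real x3, 1 + c * real w)"
    using p q r by (simp_all add: stretch_def)
  have in_grid: "(real x, 1 + c * real y) \<in> grid n (h' + 1)" if x: "x \<in> {1..n}" and y: "y \<in> {u, v, w}" for x y
  proof -
    obtain j where "c * real y = real j" "j \<le> h'" using row[OF y] by blast
    then have "(real x, 1 + c * real y) = (real x, real (j + 1))" "j + 1 \<in> {1..h' + 1}" by auto
    then show ?thesis using x unfolding mem_grid by blast
  qed
  have "?T \<subseteq> grid n (h' + 1)"
    using in_grid[OF p(2), of u] in_grid[OF q(2), of v] in_grid[OF r(2), of w]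
    by (simp add: iso(3) im)
  moreover have "isosceles_triangle ?T"
  proof -
    have "card ?T = 3" using iso(1) by (simp add: card_image inj_on_subset[OF inj_stretch[OF c(1)]])
    moreover have "\<not> collinear ?T"
    proof
      assume "collinear ?T"
      then have "collinear (stretch (inverse c) ` ?T)" by (rule collinear_stretch)
      then show False using iso(2) c(1) by (simp add: image_image stretch_inverse)
    qed
    moreover have "?T = {stretch c p, stretch c q, stretch c r}" by (simp add: iso(3))
    moreover have "dist (stretch c p) (stretch c q) = dist (stretch c p) (stretch c r)"
    proof -
      have "(c * real u - c * real v)\<^sup>2 = (c * real u - c * real w)\<^sup>2"
        using dy by (simp add: right_diff_distrib[symmetric] power_mult_distrib)
      then show ?thesis using dx by (simp add: im dist_Pair_Pair dist_real_def)
    qed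
    ultimately show ?thesis unfolding isosceles_triangle_def by blast
  qed
  moreover have "\<exists>s\<in>?T. snd s = 1" "\<exists>s\<in>?T. snd s = real h' + 1"
    using T c(2) by (force simp: spanning_def stretch_def)+
  ultimately show ?thesis by (simp add: spanning_def c_def)
qed

lemma card_spanning_le:
  assumes "n \<ge> 2" "odd n" "(n - 1)\<^sup>2 \<le> h" "(n - 1)\<^sup>2 \<le> h'" "even h = even h'"
  shows "card (spanning n h) \<le> card (spanning n h')"
proof (rule card_inj_on_le)
  have "0 < (n - 1)\<^sup>2" using assms(1) by simp
  then have "0 < h" "0 < h'" using assms(3,4) by linarith+
  then have "inj (stretch (real h' / real h))" by (intro inj_stretch) simp
  then show "inj_on ((`) (stretch (real h' / real h))) (spanning n h)"
    by (meson inj_image_eq_iff inj_onI)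
  show "(`) (stretch (real h' / real h)) ` spanning n h \<subseteq> spanning n h'"
    using stretch_spanning[OF assms] by blast
qed (rule finite_spanning)

theorem theorem6:
  fixes n k :: nat
  assumes "n \<ge> 2" and "odd n" and "k > (n - 1)^2 + 2"
  shows "int (num_isosceles n k) =
    2 * int (num_isosceles n (k - 1)) - 2 * int (num_isosceles n (k - 3)) + int (num_isosceles n (k - 4))"
proof -
  have "0 < (n - 1)\<^sup>2" using assms(1) by simp
  then have "4 \<le> k" using assms(3) by linarith
  then obtain m where k: "k = m + 4" by (metis le_add_diff_inverse2)
  have m: "(n - 1)\<^sup>2 \<le> m + 1" "(n - 1)\<^sup>2 \<le> m + 3" "even (m + 1) = even (m + 3)"
    using assms(3) k by auto
  have tall: "card (spanning n (m + 3)) = card (spanning n (m + 1))"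
    using card_spanning_le[OF assms(1,2) m(1,2,3)] card_spanning_le[OF assms(1,2) m(2,1) m(3)[symmetric]]
    by simp
  have top: "int (num_isosceles n (m + 4)) - 2 * int (num_isosceles n (m + 3))
      + int (num_isosceles n (m + 2)) = int (card (spanning n (m + 3)))"
    using second_difference[of n "m + 2"]
    by (simp only: add.assoc numeral_plus_numeral one_plus_numeral semiring_norm)
  have pred: "k - 1 = m + 3" "k - 3 = m + 1" "k - 4 = m" using k by simp_all
  show ?thesis
    unfolding pred unfolding k using top second_difference[of n m] tall by linarith
qed

end
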